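(* Let $0 < k \leq \ell$ be two natural numbers. Then there exists a graph $G_{k,\ell}$ such that $c_{\{\chi = \omega\}}(G_{k,\ell}) = k$ and $c_{\mathbf{PERF}}(G_{k,\ell}) \geq \ell$.
   Context: Graphs are finite, simple and have a nonempty vertex set; $\chi$ denotes the chromatic number and $\omega$ the clique number. For a class of graphs $\mathcal{P}$, a covering of a graph $G$ by graphs of class $\mathcal{P}$ is an expression $E(G) = E(G_1) \cup \dots \cup E(G_k)$ with $k \geq 1$, where each $G_i$ is a graph on the vertex set $V(G)$ and $G_i \in \mathcal{P}$. The cover number $c_{\mathcal{P}}(G)$ is the smallest such $k$ ($\infty$ if no covering exists). A graph is perfect if it and all of its induced subgraphs $H$ satisfy $\chi(H) = \omega(H)$. $c_{\{\chi=\omega\}}$ and $c_{\mathbf{PERF}}$ denote the cover numbers by the class $\{H \mid \chi(H) = \omega(H)\}$ and by the class of perfect graphs, respectively. *)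

theory Defs
  imports Main "HOL-Library.Extended_Nat"
begin

type_synonym 'a graph = "'a set \<times> 'a set set"

abbreviation verts :: "'a graph \<Rightarrow> 'a set" where
  "verts G \<equiv> fst G"

abbreviation edges :: "'a graph \<Rightarrow> 'a set set" where
  "edges G \<equiv> snd G"

definition is_graph :: "'a graph \<Rightarrow> bool" where
  "is_graph G \<longleftrightarrow> finite (verts G) \<and> verts G \<noteq> {} \<and>
     (\<forall>e \<in> edges G. e \<subseteq> verts G \<and> card e = 2)"

definition induced_subgraph :: "'a graph \<Rightarrow> 'a set \<Rightarrow> 'a graph" where
  "induced_subgraph G W = (W, {e \<in> edges G. e \<subseteq> W})"

definition proper_coloring :: "'a graph \<Rightarrow> nat \<Rightarrow> ('a \<Rightarrow> nat) \<Rightarrow> bool" where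
  "proper_coloring G n c \<longleftrightarrow>
     (\<forall>v \<in> verts G. c v < n) \<and>
     (\<forall>u v. {u, v} \<in> edges G \<longrightarrow> c u \<noteq> c v)"

definition chromatic_number :: "'a graph \<Rightarrow> nat" where
  "chromatic_number G = (LEAST n. \<exists>c. proper_coloring G n c)"

definition clique :: "'a graph \<Rightarrow> 'a set \<Rightarrow> bool" where
  "clique G K \<longleftrightarrow> K \<subseteq> verts G \<and>
     (\<forall>u \<in> K. \<forall>v \<in> K. u \<noteq> v \<longrightarrow> {u, v} \<in> edges G)"

definition clique_number :: "'a graph \<Rightarrow> nat" where
  "clique_number G = Max {card K | K. clique G K}"

definition chi_eq_omega :: "'a graph set" where
  "chi_eq_omega = {H. is_graph H \<and> chromatic_number H = clique_number H}"

text \<open>Taking \<open>W = verts H\<close> gives \<open>H\<close> itself; \<open>W\<close> is nonempty because graphs are.\<close>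

definition perfect_graphs :: "'a graph set" where
  "perfect_graphs = {H. is_graph H \<and>
     (\<forall>W. W \<subseteq> verts H \<and> W \<noteq> {} \<longrightarrow>
        chromatic_number (induced_subgraph H W) = clique_number (induced_subgraph H W))}"

definition is_covering ::
    "'a graph set \<Rightarrow> 'a graph \<Rightarrow> nat \<Rightarrow> (nat \<Rightarrow> 'a graph) \<Rightarrow> bool" where
  "is_covering P G n F \<longleftrightarrow> n \<ge> 1 \<and>
     (\<forall>i<n. is_graph (F i) \<and> verts (F i) = verts G \<and> F i \<in> P) \<and>
     edges G = (\<Union>i<n. edges (F i))"

text \<open>The infimum of the empty set in \<^typ>\<open>enat\<close> is \<open>\<infinity>\<close>.\<close>

definition cover_number :: "'a graph set \<Rightarrow> 'a graph \<Rightarrow> enat" where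
  "cover_number P G = Inf {enat n | n. \<exists>F. is_covering P G n F}"

end

theory Submission
  imports Defs "HOL-Library.FuncSet" "HOL-Library.Nat_Bijection"
begin

text \<open>
  If \<open>n\<close> graphs with proper \<open>w\<close>-colourings cover \<open>G\<close>, then the \<open>n\<close>-tuples of colours properly
  colour \<open>G\<close>, so \<open>\<chi>(G) \<le> w ^ n\<close> (\<open>covered_imp_proper_coloring\<close>).  How large \<open>w\<close> has to be depends
  on the class: a graph with \<open>\<chi> = \<omega>\<close> may use a large clique sitting far away from the part of \<open>G\<close>
  that is hard to colour, whereas a perfect graph has \<open>\<chi> = \<omega>\<close> on that part, too.

  The graph is therefore the disjoint union of a complete graph on \<open>w = 2 ^ l\<close> vertices and of a
  triangle-free graph \<open>T\<close> with \<open>\<chi>(T) = w ^ k\<close>.  The graphs in a covering by the class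
  \<open>\<chi> = \<omega>\<close> are \<open>w\<close>-colourable, so at least \<open>k\<close> of them are needed to reach \<open>\<chi>(T) = w ^ k\<close>.
  Conversely, writing the colours of \<open>T\<close> as \<open>k\<close>-tuples over \<open>w\<close> letters, and colouring the \<open>j\<close>-th
  vertex of the clique by \<open>(j, \<dots>, j)\<close>, the edges whose ends differ in coordinate \<open>i\<close> form a
  \<open>w\<close>-colourable graph that contains the whole clique, so it has \<open>\<chi> = \<omega> = w\<close>
  (\<open>chi_eq_omega_covering_of_tuple_coloring\<close>).  A perfect graph in a covering, on the other hand,
  induces a triangle-free perfect graph on the vertices of \<open>T\<close>, which is bipartite; hence \<open>n\<close>
  perfect graphs only give \<open>\<chi>(T) \<le> 2 ^ n\<close>, and \<open>\<chi>(T) = 2 ^ (l * k)\<close> forces \<open>n \<ge> l * k \<ge> l\<close>.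

  For \<open>T\<close> a shift graph is taken: its vertices are the pairs \<open>(i, j)\<close> with \<open>i < j < m\<close>, and
  \<open>(i, j)\<close> is adjacent to \<open>(j, h)\<close>.  It is triangle-free and its chromatic number is the least
  \<open>n\<close> with \<open>m \<le> 2 ^ n\<close>, so every chromatic number occurs.
\<close>

section \<open>Colourings and cliques\<close>

lemma edge_ends:
  assumes "is_graph G" "{u, v} \<in> edges G"
  shows "u \<in> verts G" "v \<in> verts G" "u \<noteq> v"
proof -
  have "{u, v} \<subseteq> verts G" "card {u, v} = 2"
    using assms unfolding is_graph_def by blast+
  then show "u \<in> verts G" "v \<in> verts G" "u \<noteq> v" by auto
qed

lemma proper_coloring_mono:
  assumes "proper_coloring G n c" "n \<le> n'"
  shows "proper_coloring G n' c"
  using assms unfolding proper_coloring_def by fastforce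

lemma proper_coloring_of_finite_colors:
  fixes f :: "'a \<Rightarrow> 'c"
  assumes G: "is_graph G" and C: "finite C" "f ` verts G \<subseteq> C"
    and f: "\<And>u v. {u, v} \<in> edges G \<Longrightarrow> f u \<noteq> f v"
  shows "\<exists>c. proper_coloring G (card C) c"
proof -
  obtain h where h: "bij_betw h C {0..<card C}"
    using ex_bij_betw_finite_nat[OF C(1)] by blast
  have "h (f v) < card C" if "v \<in> verts G" for v
    using bij_betwE[OF h] C(2) that by fastforce
  moreover have "h (f u) \<noteq> h (f v)" if "{u, v} \<in> edges G" for u v
    using f[OF that] edge_ends[OF G that] C(2) bij_betw_imp_inj_on[OF h]
    by (auto dest: inj_onD)
  ultimately have "proper_coloring G (card C) (\<lambda>v. h (f v))"
    unfolding proper_coloring_def by blast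
  then show ?thesis by blast
qed

lemma proper_coloring_chromatic_number:
  assumes "is_graph G"
  shows "\<exists>c. proper_coloring G (chromatic_number G) c"
proof -
  have "\<exists>c. proper_coloring G (card (verts G)) c"
    using assms by (intro proper_coloring_of_finite_colors[where f = id])
      (auto simp: is_graph_def dest: edge_ends[OF assms])
  then show ?thesis unfolding chromatic_number_def by (rule LeastI)
qed

lemma chromatic_number_le:
  assumes "proper_coloring G n c"
  shows "chromatic_number G \<le> n"
  using assms unfolding chromatic_number_def by (blast intro: Least_le)

lemma finite_clique_sizes:
  assumes "is_graph G"
  shows "finite {card K | K. clique G K}"
proof (rule finite_subset)
  show "{card K | K. clique G K} \<subseteq> card ` Pow (verts G)"
    by (auto simp: clique_def)
  show "finite (card ` Pow (verts G))"
    using assms by (simp add: is_graph_def)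
qed

lemma card_clique_le_clique_number:
  assumes "is_graph G" "clique G K"
  shows "card K \<le> clique_number G"
  unfolding clique_number_def
  using assms by (intro Max_ge finite_clique_sizes) auto

lemma clique_number_le:
  assumes "is_graph G" "\<And>K. clique G K \<Longrightarrow> card K \<le> n"
  shows "clique_number G \<le> n"
proof -
  have "clique G {}" by (simp add: clique_def)
  then have "{card K | K. clique G K} \<noteq> {}" by blast
  then show ?thesis unfolding clique_number_def
    using assms by (subst Max_le_iff[OF finite_clique_sizes]) auto
qed

lemma card_clique_le_colors:
  assumes "clique G K" "proper_coloring G n c"
  shows "card K \<le> n"
proof -
  have "inj_on c K"
    using assms unfolding clique_def proper_coloring_def inj_on_def by blast
  moreover have "c ` K \<subseteq> {..<n}"
    using assms unfolding clique_def proper_coloring_def by blast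
  ultimately show ?thesis
    using card_inj_on_le[of c K "{..<n}"] by simp
qed

text \<open>A colouring with as many colours as some clique has vertices certifies \<open>\<chi> = \<omega>\<close>.\<close>

lemma chi_eq_omegaI:
  assumes G: "is_graph G" and c: "proper_coloring G (card K) c" and K: "clique G K"
  shows "G \<in> chi_eq_omega"
proof -
  obtain c' where c': "proper_coloring G (chromatic_number G) c'"
    using proper_coloring_chromatic_number[OF G] by blast
  have "clique_number G \<le> chromatic_number G"
    using clique_number_le[OF G] card_clique_le_colors[OF _ c'] by blast
  moreover have "chromatic_number G \<le> clique_number G"
    using chromatic_number_le[OF c] card_clique_le_clique_number[OF G K] by linarith
  ultimately show ?thesis using G by (simp add: chi_eq_omega_def)
qed

lemma coloring_of_chi_eq_omega:
  assumes H: "is_graph H" "chromatic_number H = clique_number H"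
    and K: "\<And>K. clique H K \<Longrightarrow> card K \<le> n"
  shows "\<exists>c. proper_coloring H n c"
proof -
  have "chromatic_number H \<le> n"
    unfolding H(2) using H(1) K by (rule clique_number_le)
  then show ?thesis
    using proper_coloring_chromatic_number[OF H(1)] proper_coloring_mono by blast
qed

lemma clique_mono:
  assumes "clique H K" "verts H \<subseteq> verts G" "edges H \<subseteq> edges G"
  shows "clique G K"
  using assms unfolding clique_def by blast

lemma is_graph_induced_subgraph:
  assumes "is_graph G" "W \<subseteq> verts G" "W \<noteq> {}"
  shows "is_graph (induced_subgraph G W)"
  using assms by (auto simp: is_graph_def induced_subgraph_def intro: finite_subset)

section \<open>Coverings and tuples of colours\<close>

lemma covered_imp_proper_coloring:
  assumes G: "is_graph G"
    and cover: "edges G \<subseteq> (\<Union>i<n. edges (F i))"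
    and F: "\<And>i. i < n \<Longrightarrow> verts G \<subseteq> verts (F i) \<and> (\<exists>c. proper_coloring (F i) w c)"
  shows "\<exists>c. proper_coloring G (w ^ n) c"
proof -
  obtain c where c: "\<And>i. i < n \<Longrightarrow> proper_coloring (F i) w (c i)"
    using F by metis
  define f where "f v = (\<lambda>i\<in>{..<n}. c i v)" for v
  let ?C = "PiE {..<n} (\<lambda>_. {..<w})"
  have "\<exists>c. proper_coloring G (card ?C) c"
  proof (rule proper_coloring_of_finite_colors[OF G])
    show "finite ?C" by (simp add: finite_PiE)
    show "f ` verts G \<subseteq> ?C"
    proof
      fix t assume "t \<in> f ` verts G"
      then obtain v where v: "v \<in> verts G" "t = f v" by blast
      have "c i v < w" if "i < n" for i
        using F[OF that] c[OF that] v(1) unfolding proper_coloring_def by blast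
      then show "t \<in> ?C" by (simp add: v(2) f_def)
    qed
    fix u v assume "{u, v} \<in> edges G"
    then obtain i where "i < n" "{u, v} \<in> edges (F i)" using cover by blast
    then have "i < n" "c i u \<noteq> c i v"
      using c unfolding proper_coloring_def by blast+
    then show "f u \<noteq> f v"
      unfolding f_def by (metis lessThan_iff restrict_apply')
  qed
  then show ?thesis by (simp add: card_PiE)
qed

text \<open>
  Each coordinate of a tuple colouring yields the graph of those edges that it separates, and the
  clique keeps all its edges in every one of these graphs because every coordinate is injective
  on it.
\<close>

lemma chi_eq_omega_covering_of_tuple_coloring:
  fixes d :: "'a \<Rightarrow> nat \<Rightarrow> nat"
  assumes G: "is_graph G" and n: "n \<ge> 1" and K: "clique G K"
    and range: "\<And>v i. v \<in> verts G \<Longrightarrow> i < n \<Longrightarrow> d v i < card K"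
    and proper: "\<And>u v. {u, v} \<in> edges G \<Longrightarrow> \<exists>i<n. d u i \<noteq> d v i"
    and inj: "\<And>i. i < n \<Longrightarrow> inj_on (\<lambda>v. d v i) K"
  shows "\<exists>F. is_covering chi_eq_omega G n F"
proof -
  define F where "F i = (verts G, {e \<in> edges G. inj_on (\<lambda>v. d v i) e})" for i
  have graph: "is_graph (F i)" for i
    using G by (auto simp: is_graph_def F_def)
  have "F i \<in> chi_eq_omega" if "i < n" for i
  proof (rule chi_eq_omegaI)
    show "is_graph (F i)" by (rule graph)
    show "clique (F i) K"
      using K inj[OF that] unfolding clique_def F_def inj_on_def by auto
    show "proper_coloring (F i) (card K) (\<lambda>v. d v i)"
      unfolding proper_coloring_def
    proof (intro conjI ballI allI impI)
      show "d v i < card K" if "v \<in> verts (F i)" for v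
        using range \<open>i < n\<close> that by (simp add: F_def)
      fix u v assume e: "{u, v} \<in> edges (F i)"
      then have "inj_on (\<lambda>x. d x i) {u, v}" by (simp add: F_def)
      then show "d u i \<noteq> d v i"
        using edge_ends(3)[OF graph e] by simp
    qed
  qed
  moreover have "edges G = (\<Union>i<n. edges (F i))"
  proof
    show "(\<Union>i<n. edges (F i)) \<subseteq> edges G" by (auto simp: F_def)
    show "edges G \<subseteq> (\<Union>i<n. edges (F i))"
    proof
      fix e assume e: "e \<in> edges G"
      then have "card e = 2" using G by (auto simp: is_graph_def)
      then obtain u v where uv: "e = {u, v}" by (auto simp: card_2_iff)
      then obtain i where "i < n" "d u i \<noteq> d v i" using proper e by blast
      then have "i < n" "inj_on (\<lambda>x. d x i) e" by (auto simp: uv inj_on_def)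
      then show "e \<in> (\<Union>i<n. edges (F i))" using e by (auto simp: F_def)
    qed
  qed
  moreover have "verts (F i) = verts G" for i by (simp add: F_def)
  ultimately have "is_covering chi_eq_omega G n F"
    using n graph unfolding is_covering_def by blast
  then show ?thesis by blast
qed

lemma tuple_coloring_of_power_coloring:
  assumes G: "is_graph G" and c: "proper_coloring G (w ^ n) c"
  obtains d :: "'a \<Rightarrow> nat \<Rightarrow> nat"
  where "\<And>v i. v \<in> verts G \<Longrightarrow> i < n \<Longrightarrow> d v i < w"
    and "\<And>u v. {u, v} \<in> edges G \<Longrightarrow> \<exists>i<n. d u i \<noteq> d v i"
proof -
  let ?C = "PiE {..<n} (\<lambda>_. {..<w})"
  have "finite ?C" "card ?C = w ^ n" by (simp_all add: finite_PiE card_PiE)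
  then obtain h where h: "bij_betw h {0..<w ^ n} ?C"
    using ex_bij_betw_nat_finite[of ?C] by auto
  have C: "h (c v) \<in> ?C" if "v \<in> verts G" for v
    using bij_betwE[OF h] c that by (auto simp: proper_coloring_def)
  show ?thesis
  proof
    show "h (c v) i < w" if "v \<in> verts G" "i < n" for v i
      using C[OF that(1)] that(2) by (auto simp: PiE_def Pi_def)
    fix u v assume e: "{u, v} \<in> edges G"
    note uv = edge_ends[OF G e]
    have "h (c u) \<noteq> h (c v)"
      using c e uv bij_betw_imp_inj_on[OF h]
      by (auto simp: proper_coloring_def dest: inj_onD)
    then show "\<exists>i<n. h (c u) i \<noteq> h (c v) i"
      using C[OF uv(1)] C[OF uv(2)] by (meson PiE_ext lessThan_iff)
  qed
qed

section \<open>Shift graphs\<close>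

text \<open>A vertex codes the pair of its tail and its head, so that the vertices are natural numbers.\<close>

definition tail :: "nat \<Rightarrow> nat" where "tail x = fst (prod_decode x)"
definition head :: "nat \<Rightarrow> nat" where "head x = snd (prod_decode x)"

definition shift_verts :: "nat \<Rightarrow> nat set" where
  "shift_verts m = {x. tail x < head x \<and> head x < m}"

definition shift_graph :: "nat \<Rightarrow> nat graph" where
  "shift_graph m =
     (shift_verts m, {{x, y} | x y. x \<in> shift_verts m \<and> y \<in> shift_verts m \<and> head x = tail y})"

lemma tail_head_prod_encode [simp]:
  "tail (prod_encode (i, j)) = i" "head (prod_encode (i, j)) = j"
  by (simp_all add: tail_def head_def)

lemma shift_graph_edge_iff:
  "{x, y} \<in> edges (shift_graph m) \<longleftrightarrow>
     x \<in> shift_verts m \<and> y \<in> shift_verts m \<and> (head x = tail y \<or> head y = tail x)"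
  by (auto simp: shift_graph_def doubleton_eq_iff)

lemma is_graph_shift_graph:
  assumes "m \<ge> 2"
  shows "is_graph (shift_graph m)"
proof -
  have "shift_verts m \<subseteq> prod_encode ` ({..<m} \<times> {..<m})"
  proof
    fix x assume "x \<in> shift_verts m"
    then have "prod_decode x \<in> {..<m} \<times> {..<m}"
      by (auto simp: shift_verts_def tail_def head_def mem_Times_iff)
    then show "x \<in> prod_encode ` ({..<m} \<times> {..<m})"
      by (metis imageI prod_decode_inverse)
  qed
  then have "finite (shift_verts m)" by (rule finite_subset) simp
  moreover have "prod_encode (0, 1) \<in> shift_verts m"
    using assms by (simp add: shift_verts_def)
  moreover have "e \<subseteq> shift_verts m \<and> card e = 2" if e: "e \<in> edges (shift_graph m)" for e
  proof -
    obtain x y where "e = {x, y}" "x \<in> shift_verts m" "y \<in> shift_verts m" "head x = tail y"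
      using e by (auto simp: shift_graph_def)
    moreover from this have "x \<noteq> y" by (auto simp: shift_verts_def)
    ultimately show ?thesis by simp
  qed
  ultimately show ?thesis by (auto simp: is_graph_def shift_graph_def)
qed

text \<open>
  Direct the edge between \<open>(i, j)\<close> and \<open>(j, h)\<close> towards \<open>(j, h)\<close>.  Tails increase along directed
  edges, so a triangle is not a directed cycle.  If it consists of \<open>x \<rightarrow> y \<rightarrow> z\<close> and \<open>x \<rightarrow> z\<close>, then
  the tails of \<open>y\<close> and \<open>z\<close> both equal the head of \<open>x\<close>, whereas \<open>y \<rightarrow> z\<close> makes them different.
\<close>

lemma shift_graph_clique_le:
  assumes K: "clique (shift_graph m) K"
  shows "card K \<le> 2"
proof (rule ccontr)
  assume "\<not> card K \<le> 2"
  then obtain T where T: "T \<subseteq> K" "card T = 3"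
    using obtain_subset_with_card_n[of 3 K] by auto
  then obtain x y z where xyz: "T = {x, y, z}" "x \<noteq> y" "x \<noteq> z" "y \<noteq> z"
    by (auto simp: card_3_iff)
  then have "{x, y} \<in> edges (shift_graph m)" "{x, z} \<in> edges (shift_graph m)"
    "{y, z} \<in> edges (shift_graph m)"
    using T K unfolding clique_def by auto
  then show False
    unfolding shift_graph_edge_iff shift_verts_def by auto
qed

text \<open>
  For \<open>i < j\<close> the colour of \<open>(i, j)\<close> occurs among the pairs with tail \<open>i\<close>, but not among those with
  tail \<open>j\<close>, as all of these are adjacent to \<open>(i, j)\<close>.  So the \<open>m\<close> sets of colours that occur at
  the tails are pairwise distinct subsets of the \<open>n\<close> colours.
\<close>

lemma shift_graph_coloring_bound:
  assumes c: "proper_coloring (shift_graph m) n c"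
  shows "m \<le> 2 ^ n"
proof -
  define S where "S i = {c x | x. x \<in> shift_verts m \<and> tail x = i}" for i
  have neq: "S i \<noteq> S j" if "i < j" "j < m" for i j
  proof -
    have x: "prod_encode (i, j) \<in> shift_verts m"
      using that by (simp add: shift_verts_def)
    have "c (prod_encode (i, j)) \<in> S i"
      using x unfolding S_def by force
    moreover have "c (prod_encode (i, j)) \<notin> S j"
    proof
      assume "c (prod_encode (i, j)) \<in> S j"
      then obtain y where "c (prod_encode (i, j)) = c y" "y \<in> shift_verts m" "tail y = j"
        unfolding S_def by blast
      moreover from this x have "{prod_encode (i, j), y} \<in> edges (shift_graph m)"
        by (simp add: shift_graph_edge_iff)
      ultimately show False using c unfolding proper_coloring_def by blast
    qed
    ultimately show ?thesis by blast
  qed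
  have "inj_on S {..<m}"
    by (rule inj_onI) (metis lessThan_iff linorder_neqE_nat neq)
  moreover have "S ` {..<m} \<subseteq> Pow {..<n}"
    using c unfolding S_def proper_coloring_def by (auto simp: shift_graph_def)
  ultimately have "card {..<m} \<le> card (Pow {..<n})"
    by (intro card_inj_on_le) auto
  then show ?thesis by (simp add: card_Pow)
qed

lemma bit_of_greater_not_of_less:
  fixes i j :: nat
  assumes "i < j" "j < 2 ^ n"
  shows "\<exists>b<n. bit j b \<and> \<not> bit i b"
proof (rule ccontr)
  assume neg: "\<not> ?thesis"
  have "b < n" if "bit j b" for b
  proof (rule ccontr)
    assume "\<not> b < n"
    then have "(2::nat) ^ n \<le> 2 ^ b" by simp
    then have "j < 2 ^ b" using assms(2) by linarith
    then have "j div 2 ^ b = 0" by simp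
    then show False using that by (simp add: bit_iff_odd)
  qed
  then have "and i j = j" using neg by (intro bit_eqI) (auto simp: bit_and_iff)
  moreover have "and i j \<le> i"
    by (metis AND_upper1 of_nat_0_le_iff of_nat_and_eq of_nat_le_iff)
  ultimately show False using assms by simp
qed

text \<open>The pair \<open>(i, j)\<close> gets a binary place at which \<open>j\<close> has digit 1 and \<open>i\<close> has digit 0.\<close>

lemma shift_graph_coloring:
  "\<exists>c. proper_coloring (shift_graph (2 ^ n)) n c"
proof -
  have "\<forall>x. \<exists>b. x \<in> shift_verts (2 ^ n) \<longrightarrow> b < n \<and> bit (head x) b \<and> \<not> bit (tail x) b"
    using bit_of_greater_not_of_less unfolding shift_verts_def by blast
  then obtain c where c: "\<And>x. x \<in> shift_verts (2 ^ n) \<Longrightarrow>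
      c x < n \<and> bit (head x) (c x) \<and> \<not> bit (tail x) (c x)"
    by metis
  have "proper_coloring (shift_graph (2 ^ n)) n c"
    unfolding proper_coloring_def
  proof (intro conjI ballI allI impI)
    show "c x < n" if "x \<in> verts (shift_graph (2 ^ n))" for x
      using c that by (simp add: shift_graph_def)
    show "c x \<noteq> c y" if "{x, y} \<in> edges (shift_graph (2 ^ n))" for x y
      using c[of x] c[of y] that unfolding shift_graph_edge_iff by metis
  qed
  then show ?thesis by blast
qed

section \<open>Adding a complete component\<close>

definition add_complete_component :: "'a graph \<Rightarrow> 'a set \<Rightarrow> 'a graph" where
  "add_complete_component T K =
     (verts T \<union> K, edges T \<union> {{u, v} | u v. u \<in> K \<and> v \<in> K \<and> u \<noteq> v})"

lemma is_graph_add_complete_component: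
  assumes "is_graph T" "finite K"
  shows "is_graph (add_complete_component T K)"
  using assms by (auto simp: is_graph_def add_complete_component_def)

lemma add_complete_component_edge_iff:
  "{u, v} \<in> edges (add_complete_component T K) \<longleftrightarrow>
    {u, v} \<in> edges T \<or> u \<in> K \<and> v \<in> K \<and> u \<noteq> v"
  by (auto simp: add_complete_component_def doubleton_eq_iff)

lemma clique_add_complete_component:
  "clique (add_complete_component T K) K"
  by (auto simp: clique_def add_complete_component_def)

lemma edges_add_complete_component_inside:
  assumes "is_graph T" "verts T \<inter> K = {}"
  shows "{e \<in> edges (add_complete_component T K). e \<subseteq> verts T} = edges T"
  using assms by (auto simp: is_graph_def add_complete_component_def)

lemma clique_add_complete_component_cases:
  assumes T: "is_graph T" "verts T \<inter> K = {}" and Q: "clique (add_complete_component T K) Q"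
  shows "clique T Q \<or> Q \<subseteq> K"
proof (rule disjCI)
  assume "\<not> Q \<subseteq> K"
  then obtain x where x: "x \<in> Q" "x \<notin> K" by blast
  have edge: "{u, v} \<in> edges T \<or> u \<in> K \<and> v \<in> K" if "u \<in> Q" "v \<in> Q" "u \<noteq> v" for u v
    using Q that add_complete_component_edge_iff[of u v T K] unfolding clique_def by blast
  have QT: "y \<in> verts T" if "y \<in> Q" for y
  proof (cases "y = x")
    case True
    then show ?thesis
      using Q x by (auto simp: clique_def add_complete_component_def)
  next
    case False
    then show ?thesis using edge[OF x(1) that] x edge_ends[OF T(1)] by blast
  qed
  then show "clique T Q"
    using edge T(2) unfolding clique_def by blast
qed

section \<open>The separation\<close>

lemma cover_number_greatest:
  assumes "\<And>n F. is_covering P G n F \<Longrightarrow> m \<le> n"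
  shows "enat m \<le> cover_number P G"
  unfolding cover_number_def by (rule Inf_greatest) (use assms in auto)

lemma cover_number_least:
  assumes "is_covering P G n F"
  shows "cover_number P G \<le> enat n"
  unfolding cover_number_def by (rule Inf_lower) (use assms in auto)

theorem theorem7:
  fixes k l :: nat
  assumes "0 < k" and "k \<le> l"
  shows "\<exists>G :: nat graph. is_graph G \<and>
    cover_number chi_eq_omega G = enat k \<and>
    cover_number perfect_graphs G \<ge> enat l"
proof -
  define w :: nat where "w = 2 ^ l"
  have "l \<ge> 1" using assms by simp
  then have w: "w \<ge> 2" unfolding w_def using power_increasing[of 1 l "2::nat"] by simp
  define T where "T = shift_graph (2 ^ (w ^ k))"
  have "w ^ k \<ge> 1" using w by simp
  then have "(2::nat) ^ (w ^ k) \<ge> 2" using power_increasing[of 1 "w ^ k" "2::nat"] by simp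
  then have T: "is_graph T" unfolding T_def by (rule is_graph_shift_graph)
  have T_coloring: "\<exists>c. proper_coloring T (w ^ k) c"
    unfolding T_def by (rule shift_graph_coloring)
  have T_bound: "w ^ k \<le> n" if "\<exists>c. proper_coloring T n c" for n
    using that shift_graph_coloring_bound unfolding T_def by fastforce
  have T_clique: "card Q \<le> 2" if "clique T Q" for Q
    using that shift_graph_clique_le unfolding T_def by blast

  \<comment> \<open>All vertices of \<open>T\<close> lie below some \<open>N\<close>, so the numbers from \<open>N\<close> on are free for the clique.\<close>
  obtain N where N: "\<And>x. x \<in> verts T \<Longrightarrow> x < N"
    using T finite_nat_set_iff_bounded by (auto simp: is_graph_def)
  define K where "K = {N..<N + w}"
  define G where "G = add_complete_component T K"
  have disj: "verts T \<inter> K = {}" using N by (fastforce simp: K_def)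
  have K: "finite K" "card K = w" by (simp_all add: K_def)
  have G: "is_graph G" unfolding G_def using T K by (intro is_graph_add_complete_component)
  have TG: "verts T \<subseteq> verts G" "verts T \<noteq> {}"
    using T by (auto simp: G_def add_complete_component_def is_graph_def)
  have inside: "{e \<in> edges G. e \<subseteq> verts T} = edges T"
    unfolding G_def using T disj by (rule edges_add_complete_component_inside)
  have G_clique: "card Q \<le> w" if "clique G Q" for Q
    using clique_add_complete_component_cases[OF T disj that[unfolded G_def]] T_clique w K
      card_mono[OF K(1)] by fastforce

  have upper: "\<exists>F. is_covering chi_eq_omega G k F"
  proof -
    obtain c where "proper_coloring T (w ^ k) c" using T_coloring ..
    then obtain d where d: "\<And>v i. v \<in> verts T \<Longrightarrow> i < k \<Longrightarrow> d v i < w"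
        "\<And>u v. {u, v} \<in> edges T \<Longrightarrow> \<exists>i<k. d u i \<noteq> d v i"
      using tuple_coloring_of_power_coloring[OF T] by blast
    \<comment> \<open>The clique vertex \<open>N + j\<close> gets the constant tuple \<open>(j, \<dots>, j)\<close>.\<close>
    define d' where "d' v i = (if v \<in> K then v - N else d v i)" for v i
    show ?thesis
    proof (rule chi_eq_omega_covering_of_tuple_coloring[OF G])
      show "k \<ge> 1" using assms by simp
      show "clique G K" unfolding G_def by (rule clique_add_complete_component)
      show "d' v i < card K" if "v \<in> verts G" "i < k" for v i
        using that d(1) K by (auto simp: d'_def G_def add_complete_component_def K_def)
      show "\<exists>i<k. d' u i \<noteq> d' v i" if e: "{u, v} \<in> edges G" for u v
      proof (cases "{u, v} \<in> edges T")
        case True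
        then have "u \<notin> K" "v \<notin> K" using edge_ends[OF T True] disj by blast+
        then show ?thesis using d(2)[OF True] by (simp add: d'_def)
      next
        case False
        then have "u \<in> K" "v \<in> K" "u \<noteq> v"
          using e add_complete_component_edge_iff[of u v T K] unfolding G_def by blast+
        then show ?thesis using assms by (auto simp: d'_def K_def)
      qed
      show "inj_on (\<lambda>v. d' v i) K" if "i < k" for i
        by (auto simp: inj_on_def d'_def K_def)
    qed
  qed

  have lower: "k \<le> n" if F: "is_covering chi_eq_omega G n F" for n F
  proof -
    have "\<exists>c. proper_coloring T (w ^ n) c"
    proof (rule covered_imp_proper_coloring[OF T])
      show "edges T \<subseteq> (\<Union>i<n. edges (F i))"
        using inside F unfolding is_covering_def by blast
      fix i assume i: "i < n"
      then have Fi: "is_graph (F i)" "verts (F i) = verts G" "edges (F i) \<subseteq> edges G"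
          "chromatic_number (F i) = clique_number (F i)"
        using F unfolding is_covering_def chi_eq_omega_def by blast+
      have "\<exists>c. proper_coloring (F i) w c"
        using Fi(1,4) by (rule coloring_of_chi_eq_omega)
          (use G_clique clique_mono Fi(2,3) in blast)
      then show "verts T \<subseteq> verts (F i) \<and> (\<exists>c. proper_coloring (F i) w c)"
        using TG Fi by simp
    qed
    then have "w ^ k \<le> w ^ n" by (rule T_bound)
    then show ?thesis using w by simp
  qed

  have perfect: "l \<le> n" if F: "is_covering perfect_graphs G n F" for n F
  proof -
    let ?H = "\<lambda>i. induced_subgraph (F i) (verts T)"
    have "\<exists>c. proper_coloring T (2 ^ n) c"
    proof (rule covered_imp_proper_coloring[OF T])
      show "edges T \<subseteq> (\<Union>i<n. edges (?H i))"
        using inside F unfolding is_covering_def induced_subgraph_def by auto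
      fix i assume i: "i < n"
      then have Fi: "is_graph (F i)" "verts (F i) = verts G" "edges (F i) \<subseteq> edges G"
          "F i \<in> perfect_graphs"
        using F unfolding is_covering_def by blast+
      have HT: "verts (?H i) = verts T" "edges (?H i) \<subseteq> edges T"
        using inside Fi(3) by (auto simp: induced_subgraph_def)
      have "is_graph (?H i)"
        using Fi TG by (intro is_graph_induced_subgraph) auto
      moreover have "chromatic_number (?H i) = clique_number (?H i)"
        using Fi TG unfolding perfect_graphs_def by auto
      ultimately have "\<exists>c. proper_coloring (?H i) 2 c"
        by (rule coloring_of_chi_eq_omega) (use T_clique clique_mono HT in blast)
      then show "verts T \<subseteq> verts (?H i) \<and> (\<exists>c. proper_coloring (?H i) 2 c)"
        using HT by simp
    qed
    then have "w ^ k \<le> 2 ^ n" by (rule T_bound)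
    then have "(2::nat) ^ (l * k) \<le> 2 ^ n" by (simp add: w_def power_mult)
    then have "l * k \<le> n" by simp
    moreover have "l \<le> l * k" using assms by simp
    ultimately show ?thesis by (rule order_trans[rotated])
  qed

  have "cover_number chi_eq_omega G = enat k"
    using upper lower cover_number_least cover_number_greatest by (metis antisym)
  moreover have "cover_number perfect_graphs G \<ge> enat l"
    using perfect by (rule cover_number_greatest)
  ultimately show ?thesis using G by blast
qed

end
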